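(* Let $(X,\mathsf d,\mu)$ be a proper metric measure space, let $\Omega\subseteq X$ be a bounded domain, and let $u\in L^1_{\mathrm{loc}}(\Omega,\mu)$ be an upper semicontinuous function in $\overline\Omega$ such that $\overline\Delta{}_\mu^{\mathsf d}u\ge0$ in $\Omega$. Assume that there exists a bounded function $\phi$ which is upper semicontinuous in $\overline\Omega$ and such that $\underline\Delta{}_\mu^{\mathsf d}\phi>0$ in $\Omega$. Then $$\max_{\partial\Omega}u=\max_{\overline\Omega}u.$$
   Context: A metric measure space $(X,\mathsf d,\mu)$ is a metric space with a Borel measure $\mu$ such that $\mu(U)>0$ for every non-empty open $U\subset X$ (balls are understood to have finite measure so that averages over balls make sense). It is proper if all closed bounded subsets are compact. A domain is a non-empty connected open set. Functions may take values in $\overline{\mathbb R}=[-\infty,+\infty]$. Convention: a function $u\in L^1_{\mathrm{loc}}$ is evaluated pointwise through its representative whose value at $x$ is $\lim_{r\to0^+}\mu(B_r(x))^{-1}\int_{B_r(x)}u\,d\mu$ whenever this limit exists. With $B_r(x)$ the ball of center $x$ and radius $r$, set for $x\in\Omega$ (and $r$ small) $$\Delta_{\mu,r}^{\mathsf d}u(x):=\frac1{r^2}\,\frac1{\mu(B_r(x))}\int_{B_r(x)}\big(u(y)-u(x)\big)\,d\mu(y),$$ and define the upper and lower AMV (asymptotic mean value) Laplacians $$\overline\Delta{}_\mu^{\mathsf d}u(x):=\limsup_{r\to0^+}\Delta_{\mu,r}^{\mathsf d}u(x),\qquad \underline\Delta{}_\mu^{\mathsf d}u(x):=\liminf_{r\to0^+}\Delta_{\mu,r}^{\mathsf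 d}u(x).$$ Inequalities "in $\Omega$" are meant at every point of $\Omega$. *)

theory Defs
  imports "HOL-Analysis.Analysis"
begin

text \<open>
  The metric space \<open>X\<close> is the whole type \<open>'a\<close>, with distance \<open>dist\<close>. Properness is the type class
  \<open>heine_borel\<close> (bounded sequences have convergent subsequences), which for metric spaces is the same
  as compactness of all closed bounded subsets. Functions defined on a subset of \<open>X\<close> are
  modelled by total functions whose values outside that subset are irrelevant.
\<close>

locale metric_measure_space =
  fixes \<mu> :: "'a::metric_space measure"
  assumes sets_borel: "sets \<mu> = sets borel"
    and open_pos: "open U \<Longrightarrow> U \<noteq> {} \<Longrightarrow> emeasure \<mu> U > 0"
    and ball_finite: "emeasure \<mu> (ball x r) < \<infinity>"

definition bounded_domain :: "'a::metric_space set \<Rightarrow> bool" where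
  "bounded_domain \<Omega> \<longleftrightarrow> \<Omega> \<noteq> {} \<and> open \<Omega> \<and> connected \<Omega> \<and> bounded \<Omega>"

definition usc_on :: "'a::topological_space set \<Rightarrow> ('a \<Rightarrow> ereal) \<Rightarrow> bool" where
  "usc_on S f \<longleftrightarrow> (\<forall>x\<in>S. Limsup (at x within S) f \<le> f x)"

definition L1_loc :: "'a::topological_space measure \<Rightarrow> 'a set \<Rightarrow> ('a \<Rightarrow> ereal) \<Rightarrow> bool" where
  "L1_loc \<mu> \<Omega> u \<longleftrightarrow> u \<in> borel_measurable (restrict_space \<mu> \<Omega>) \<and>
     (\<forall>K. compact K \<and> K \<subseteq> \<Omega> \<longrightarrow> (\<integral>\<^sup>+y\<in>K. e2ennreal \<bar>u y\<bar> \<partial>\<mu>) < \<infinity>)"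

text \<open>
  Integral of an extended real valued function over \<open>A\<close>, as the difference of the integrals of its
  positive and negative parts (\<open>e2ennreal\<close> sends negative numbers to \<open>0\<close>). The difference is
  meaningful when at least one of the two is finite; otherwise it has the arbitrary value
  \<open>\<infinity> - \<infinity> = \<infinity>\<close>. For \<open>u\<close> integrable over \<open>A\<close> with finite measure and any \<open>c\<close>, the integral of
  \<open>u - c\<close> is always meaningful: it is finite for finite \<open>c\<close>, and equals \<open>-\<infinity>\<close> for \<open>c = \<infinity>\<close>
  and \<open>\<infinity>\<close> for \<open>c = -\<infinity>\<close> if \<open>A\<close> has positive measure.
\<close>

definition ext_integral :: "'a measure \<Rightarrow> 'a set \<Rightarrow> ('a \<Rightarrow> ereal) \<Rightarrow> ereal" where
  "ext_integral \<mu> A f =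
     enn2ereal (\<integral>\<^sup>+y\<in>A. e2ennreal (f y) \<partial>\<mu>) - enn2ereal (\<integral>\<^sup>+y\<in>A. e2ennreal (- f y) \<partial>\<mu>)"

definition ball_average :: "'a::metric_space measure \<Rightarrow> real \<Rightarrow> 'a \<Rightarrow> ('a \<Rightarrow> ereal) \<Rightarrow> ereal" where
  "ball_average \<mu> r x f = ereal (1 / measure \<mu> (ball x r)) * ext_integral \<mu> (ball x r) f"

text \<open>
  The pointwise convention for locally integrable functions: the value at a point is the limit of
  the averages over balls shrinking to it, whenever this limit exists.
\<close>

definition limit_of_averages_on :: "'a::metric_space measure \<Rightarrow> 'a set \<Rightarrow> ('a \<Rightarrow> ereal) \<Rightarrow> bool" where
  "limit_of_averages_on \<mu> \<Omega> u \<longleftrightarrow>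
     (\<forall>x\<in>\<Omega>. \<forall>L. ((\<lambda>r. ball_average \<mu> r x u) \<longlongrightarrow> L) (at_right 0) \<longrightarrow> u x = L)"

definition AMV_quotient :: "'a::metric_space measure \<Rightarrow> real \<Rightarrow> ('a \<Rightarrow> ereal) \<Rightarrow> 'a \<Rightarrow> ereal" where
  "AMV_quotient \<mu> r u x = ereal (1 / r\<^sup>2) * ball_average \<mu> r x (\<lambda>y. u y - u x)"

definition upper_AMV_Laplacian :: "'a::metric_space measure \<Rightarrow> ('a \<Rightarrow> ereal) \<Rightarrow> 'a \<Rightarrow> ereal" where
  "upper_AMV_Laplacian \<mu> u x = Limsup (at_right 0) (\<lambda>r. AMV_quotient \<mu> r u x)"

definition lower_AMV_Laplacian :: "'a::metric_space measure \<Rightarrow> ('a \<Rightarrow> ereal) \<Rightarrow> 'a \<Rightarrow> ereal" where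
  "lower_AMV_Laplacian \<mu> u x = Liminf (at_right 0) (\<lambda>r. AMV_quotient \<mu> r u x)"

definition is_max_on :: "('a \<Rightarrow> ereal) \<Rightarrow> 'a set \<Rightarrow> ereal \<Rightarrow> bool" where
  "is_max_on f S M \<longleftrightarrow> M \<in> f ` S \<and> (\<forall>x\<in>S. f x \<le> M)"

end

theory Submission
  imports Defs
begin

text \<open>
  Suppose the maximum \<open>M\<close> of \<open>u\<close> over the compact set \<open>closure \<Omega>\<close> is not attained on the frontier.
  If \<open>M\<close> is finite, the frontier values of \<open>u\<close> stay below some \<open>c < M\<close>, so for small \<open>\<epsilon> > 0\<close> the
  upper semicontinuous function \<open>u + \<epsilon> \<phi>\<close> still attains its maximum over \<open>closure \<Omega>\<close> only inside
  \<open>\<Omega>\<close>, say at \<open>x\<close>. There \<open>u y - u x \<le> - \<epsilon> (\<phi> y - \<phi> x)\<close>; averaging over small balls shows that the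
  upper Laplacian of \<open>u\<close> at \<open>x\<close> is at most \<open>- \<epsilon>\<close> times the lower Laplacian of \<open>\<phi>\<close>, a contradiction
  (\<open>upper_AMV_Laplacian_neg_at_perturbed_max\<close>, \<open>max_attained_on_frontier\<close>).

  Two degenerate situations remain. The value \<open>M = \<infinity>\<close> cannot occur at a point of \<open>\<Omega>\<close>: a locally
  integrable function is finite almost everywhere, so at a point where it is \<open>\<infinity>\<close> all averages of
  \<open>u y - u x\<close> over small balls are \<open>-\<infinity>\<close> (\<open>upper_AMV_Laplacian_neg_at_PInfty\<close>). And the
  frontier is not empty, because the finite case applied to the zero function finds a point of the frontier; in particular the case \<open>M = -\<infinity>\<close> is trivial.
\<close>

section \<open>Upper semicontinuity\<close>

lemma usc_on_iff_eventually_less: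
  "usc_on S f \<longleftrightarrow> (\<forall>x\<in>S. \<forall>c>f x. eventually (\<lambda>y. f y < c) (at x within S))"
  unfolding usc_on_def Limsup_le_iff by auto

lemma usc_on_subset:
  assumes "usc_on S f" "T \<subseteq> S"
  shows "usc_on T f"
  using assms unfolding usc_on_iff_eventually_less
  by (meson at_le filter_leD subsetD)

lemma usc_on_obtains_open_less:
  assumes "usc_on S f" "x \<in> S" "f x < c"
  obtains U where "open U" "x \<in> U" "\<And>y. y \<in> U \<Longrightarrow> y \<in> S \<Longrightarrow> f y < c"
proof -
  have "eventually (\<lambda>y. f y < c) (at x within S)"
    using assms unfolding usc_on_iff_eventually_less by blast
  then obtain U where "open U" "x \<in> U" "\<And>y. y \<in> U \<Longrightarrow> y \<noteq> x \<Longrightarrow> y \<in> S \<Longrightarrow> f y < c"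
    unfolding eventually_at_topological by blast
  with \<open>f x < c\<close> show ?thesis
    by (intro that[of U]) auto
qed

text \<open>
  If every \<open>x\<close> had some \<open>g x\<close> in \<open>K\<close> with \<open>f x < f (g x)\<close>, finitely many of the open sets on which
  \<open>f\<close> stays below \<open>f (g x)\<close> would cover \<open>K\<close>; the largest of the corresponding values \<open>f (g x)\<close> is
  itself a value of \<open>f\<close> on \<open>K\<close> and would lie below one of them.
\<close>
lemma usc_on_compact_attains_max:
  assumes usc: "usc_on K f" and K: "compact K" "K \<noteq> {}"
  obtains x where "x \<in> K" "\<And>y. y \<in> K \<Longrightarrow> f y \<le> f x"
proof (rule ccontr)
  assume "\<not> thesis"
  then have "\<forall>x\<in>K. \<exists>y\<in>K. f x < f y"
    using that by (meson not_le)
  then obtain g where g: "\<And>x. x \<in> K \<Longrightarrow> g x \<in> K" "\<And>x. x \<in> K \<Longrightarrow> f x < f (g x)"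
    by metis
  have "\<forall>x\<in>K. \<exists>U. open U \<and> x \<in> U \<and> (\<forall>y\<in>U \<inter> K. f y < f (g x))"
    by (metis IntE g(2) usc usc_on_obtains_open_less)
  then obtain U where U: "\<And>x. x \<in> K \<Longrightarrow> open (U x)" "\<And>x. x \<in> K \<Longrightarrow> x \<in> U x"
      "\<And>x y. x \<in> K \<Longrightarrow> y \<in> U x \<Longrightarrow> y \<in> K \<Longrightarrow> f y < f (g x)"
    by (metis IntI)
  obtain C where C: "C \<subseteq> K" "finite C" "K \<subseteq> (\<Union>x\<in>C. U x)"
    using compactE_image[OF K(1), of K U] U by (metis UN_iff subsetI)
  have "C \<noteq> {}" using C K(2) by auto
  define m where "m = Max ((\<lambda>x. f (g x)) ` C)"
  have "m \<in> (\<lambda>x. f (g x)) ` C"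
    unfolding m_def using C \<open>C \<noteq> {}\<close> by (intro Max_in) auto
  then obtain p where p: "p \<in> C" "m = f (g p)" by auto
  then have "g p \<in> K" using g C by auto
  then obtain q where q: "q \<in> C" "g p \<in> U q" using C by auto
  have "m < f (g q)" using U(3)[of q "g p"] q p C \<open>g p \<in> K\<close> by auto
  moreover have "f (g q) \<le> m"
    unfolding m_def using C q by (intro Max_ge) auto
  ultimately show False by simp
qed

lemma usc_on_add_scaled:
  fixes u :: "'a::topological_space \<Rightarrow> ereal" and \<phi> :: "'a \<Rightarrow> real"
  assumes u: "usc_on S u" and \<phi>: "usc_on S (\<lambda>x. ereal (\<phi> x))" and "\<epsilon> > 0"
  shows "usc_on S (\<lambda>x. u x + ereal (\<epsilon> * \<phi> x))"
  unfolding usc_on_iff_eventually_less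
proof (intro ballI allI impI)
  fix x c assume x: "x \<in> S" and less: "u x + ereal (\<epsilon> * \<phi> x) < c"
  \<comment> \<open>Split the slack between \<open>u\<close> and \<open>\<epsilon> \<phi>\<close>; real bounds also cover \<open>u x = -\<infinity>\<close> and \<open>c = \<infinity>\<close>.\<close>
  have "u x < c - ereal (\<epsilon> * \<phi> x)"
    using less by (simp add: ereal_less_minus)
  then obtain c1 where c1: "u x < ereal c1" "ereal c1 < c - ereal (\<epsilon> * \<phi> x)"
    using ereal_dense2 by blast
  then obtain c2 where c2: "ereal c1 < ereal c2" "ereal c2 < c - ereal (\<epsilon> * \<phi> x)"
    using ereal_dense2 by blast
  have below: "ereal (c2 + \<epsilon> * \<phi> x) < c"
    using c2(2) by (simp add: ereal_less_minus)
  have "eventually (\<lambda>y. u y < ereal c1) (at x within S)"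
    using u x c1 unfolding usc_on_iff_eventually_less by blast
  moreover have "eventually (\<lambda>y. ereal (\<phi> y) < ereal (\<phi> x + (c2 - c1) / \<epsilon>)) (at x within S)"
  proof -
    have "ereal (\<phi> x) < ereal (\<phi> x + (c2 - c1) / \<epsilon>)"
      using c2(1) \<open>\<epsilon> > 0\<close> by simp
    then show ?thesis
      using \<phi> x unfolding usc_on_iff_eventually_less by blast
  qed
  ultimately show "eventually (\<lambda>y. u y + ereal (\<epsilon> * \<phi> y) < c) (at x within S)"
  proof eventually_elim
    case (elim y)
    have "\<epsilon> * \<phi> y < \<epsilon> * \<phi> x + (c2 - c1)"
      using elim(2) \<open>\<epsilon> > 0\<close> by (simp add: field_simps)
    then have "u y + ereal (\<epsilon> * \<phi> y) \<le> ereal (c2 + \<epsilon> * \<phi> x)"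
      using elim(1) by (cases "u y") auto
    with below show ?case by simp
  qed
qed

lemma usc_on_open_borel_measurable:
  fixes \<phi> :: "'a::topological_space \<Rightarrow> real"
  assumes usc: "usc_on \<Omega> (\<lambda>x. ereal (\<phi> x))" and "open \<Omega>" and borel: "sets \<mu> = sets borel"
  shows "\<phi> \<in> borel_measurable (restrict_space \<mu> \<Omega>)"
proof (rule borel_measurableI_less)
  fix c
  have "open {x \<in> \<Omega>. \<phi> x < c}"
  proof (rule open_subopen[THEN iffD2], intro ballI)
    fix x assume x: "x \<in> {x \<in> \<Omega>. \<phi> x < c}"
    then obtain U where "open U" "x \<in> U" "\<And>y. y \<in> U \<Longrightarrow> y \<in> \<Omega> \<Longrightarrow> ereal (\<phi> y) < ereal c"
      using usc_on_obtains_open_less[OF usc, of x "ereal c"]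
      by (metis (mono_tags, lifting) ereal_less_eq(3) mem_Collect_eq not_le)
    with x \<open>open \<Omega>\<close> show "\<exists>T. open T \<and> x \<in> T \<and> T \<subseteq> {x \<in> \<Omega>. \<phi> x < c}"
      by (intro exI[of _ "U \<inter> \<Omega>"]) auto
  qed
  moreover have "space \<mu> = UNIV" using sets_eq_imp_space_eq[OF borel] by simp
  ultimately show "{x \<in> space (restrict_space \<mu> \<Omega>). \<phi> x < c} \<in> sets (restrict_space \<mu> \<Omega>)"
    using \<open>open \<Omega>\<close> borel
    by (auto simp: sets_restrict_space_iff space_restrict_space)
qed

section \<open>Averages over small balls\<close>

text \<open>
  The positive part of the integrand grows and the negative part shrinks, and the nonnegative
  integral is monotone for arbitrary functions. The function \<open>u\<close> enters the estimates only
  through this comparison with integrands built from \<open>\<phi>\<close>.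
\<close>
lemma ext_integral_mono:
  assumes "\<And>y. y \<in> A \<Longrightarrow> f y \<le> g y"
  shows "ext_integral \<mu> A f \<le> ext_integral \<mu> A g"
  unfolding ext_integral_def
proof (intro ereal_minus_mono)
  show "enn2ereal (\<integral>\<^sup>+y\<in>A. e2ennreal (f y) \<partial>\<mu>) \<le> enn2ereal (\<integral>\<^sup>+y\<in>A. e2ennreal (g y) \<partial>\<mu>)"
    using assms by (auto intro!: nn_integral_mono e2ennreal_mono simp: less_eq_ennreal.rep_eq[symmetric]
        split: split_indicator)
  show "enn2ereal (\<integral>\<^sup>+y\<in>A. e2ennreal (- g y) \<partial>\<mu>) \<le> enn2ereal (\<integral>\<^sup>+y\<in>A. e2ennreal (- f y) \<partial>\<mu>)"
    using assms by (auto intro!: nn_integral_mono e2ennreal_mono simp: less_eq_ennreal.rep_eq[symmetric]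
        split: split_indicator)
qed

lemma ext_integral_eq_set_integral:
  fixes g :: "'a \<Rightarrow> real"
  assumes "set_integrable \<mu> A g"
  shows "ext_integral \<mu> A (\<lambda>y. ereal (g y)) = ereal (LINT y:A|\<mu>. g y)"
proof -
  let ?h = "\<lambda>y. indicator A y *\<^sub>R g y"
  have int: "integrable \<mu> ?h" using assms unfolding set_integrable_def .
  have pos: "(\<integral>\<^sup>+y\<in>A. e2ennreal (ereal (g y)) \<partial>\<mu>) = (\<integral>\<^sup>+y. ennreal (?h y) \<partial>\<mu>)"
    by (intro nn_integral_cong) (auto split: split_indicator simp: e2ennreal_ereal)
  have neg: "(\<integral>\<^sup>+y\<in>A. e2ennreal (- ereal (g y)) \<partial>\<mu>) = (\<integral>\<^sup>+y. ennreal (- ?h y) \<partial>\<mu>)"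
    by (intro nn_integral_cong) (auto split: split_indicator simp: e2ennreal_ereal)
  obtain p where p: "(\<integral>\<^sup>+y. ennreal (?h y) \<partial>\<mu>) = ennreal p" "p \<ge> 0"
    using real_integrable_def[THEN iffD1, OF int]
    by (metis ennreal_cases infinity_ennreal_def)
  obtain n where n: "(\<integral>\<^sup>+y. ennreal (- ?h y) \<partial>\<mu>) = ennreal n" "n \<ge> 0"
    using real_integrable_def[THEN iffD1, OF int]
    by (metis ennreal_cases infinity_ennreal_def)
  show ?thesis
    unfolding ext_integral_def pos neg set_lebesgue_integral_def real_lebesgue_integral_def[OF int] p n
    using p(2) n(2) by (simp add: enn2ereal_ennreal)
qed

lemma eventually_small_ball:
  fixes x :: "'a::metric_space"
  assumes "open \<Omega>" "x \<in> \<Omega>"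
  shows "eventually (\<lambda>r. 0 < r \<and> cball x r \<subseteq> \<Omega>) (at_right (0::real))"
proof -
  obtain e where e: "e > 0" "cball x e \<subseteq> \<Omega>"
    using assms open_contains_cball by blast
  then show ?thesis
    by (intro eventually_at_rightI[of 0 e]) auto
qed

lemma (in metric_measure_space) measure_ball_pos:
  assumes "r > 0"
  shows "measure \<mu> (ball x r) > 0"
proof -
  have "emeasure \<mu> (ball x r) > 0" using assms by (intro open_pos) auto
  then show ?thesis
    using ball_finite[of x r] by (simp add: measure_def enn2real_positive_iff)
qed

lemma (in metric_measure_space) set_integrable_bounded_ball:
  fixes \<phi> :: "'a \<Rightarrow> real"
  assumes meas: "\<phi> \<in> borel_measurable (restrict_space \<mu> \<Omega>)"
    and "ball x r \<subseteq> \<Omega>" and bound: "\<And>y. y \<in> \<Omega> \<Longrightarrow> \<bar>\<phi> y\<bar> \<le> B"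
  shows "set_integrable \<mu> (ball x r) \<phi>"
proof -
  have sp: "space \<mu> = UNIV" using sets_eq_imp_space_eq[OF sets_borel] by simp
  have sets: "ball x r \<in> sets \<mu>"
    using sets_borel by auto
  have "\<phi> \<in> borel_measurable (restrict_space \<mu> (ball x r))"
    using meas \<open>ball x r \<subseteq> \<Omega>\<close> by (rule measurable_restrict_mono)
  then have sbm: "set_borel_measurable \<mu> (ball x r) \<phi>"
    unfolding set_borel_measurable_def
    using borel_measurable_restrict_space_iff[of "ball x r" \<mu> \<phi>] sets by (simp add: sp)
  have const: "set_integrable \<mu> (ball x r) (\<lambda>_. B)"
    unfolding set_integrable_def using sets ball_finite by simp
  have "AE y in \<mu>. y \<in> ball x r \<longrightarrow> norm (\<phi> y) \<le> norm B"
    using bound assms(2) by (intro AE_I2) force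
  with const sbm show ?thesis
    by (rule set_integrable_bound)
qed

section \<open>The Laplacian at interior maxima\<close>

text \<open>
  Maximality says \<open>u y - u x \<le> - \<epsilon> (\<phi> y - \<phi> x)\<close> on small balls, and the right-hand side is
  integrable because \<open>\<phi>\<close> is bounded, so the AMV quotient of \<open>u\<close> is at most \<open>- \<epsilon>\<close> times that
  of \<open>\<phi>\<close>, which stays above a positive number as \<open>r\<close> tends to \<open>0\<close>.
\<close>
lemma (in metric_measure_space) upper_AMV_Laplacian_neg_at_perturbed_max:
  fixes u :: "'a \<Rightarrow> ereal" and \<phi> :: "'a \<Rightarrow> real"
  assumes "open \<Omega>" "x \<in> \<Omega>" "\<epsilon> > 0"
    and meas: "\<phi> \<in> borel_measurable (restrict_space \<mu> \<Omega>)"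
    and bound: "\<And>y. y \<in> \<Omega> \<Longrightarrow> \<bar>\<phi> y\<bar> \<le> B"
    and ux: "u x = ereal a"
    and max: "\<And>y. y \<in> \<Omega> \<Longrightarrow> u y + ereal (\<epsilon> * \<phi> y) \<le> u x + ereal (\<epsilon> * \<phi> x)"
    and lower: "lower_AMV_Laplacian \<mu> (\<lambda>x. ereal (\<phi> x)) x > 0"
  shows "upper_AMV_Laplacian \<mu> u x < 0"
proof -
  obtain \<delta> where \<delta>: "0 < ereal \<delta>" "ereal \<delta> < lower_AMV_Laplacian \<mu> (\<lambda>x. ereal (\<phi> x)) x"
    using lower ereal_dense2 by blast
  have "eventually (\<lambda>r. ereal \<delta> < AMV_quotient \<mu> r (\<lambda>x. ereal (\<phi> x)) x) (at_right 0)"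
    using \<delta>(2) unfolding lower_AMV_Laplacian_def by (rule less_LiminfD)
  with eventually_small_ball[OF assms(1,2)]
  have "eventually (\<lambda>r. AMV_quotient \<mu> r u x \<le> ereal (- \<epsilon> * \<delta>)) (at_right 0)"
  proof eventually_elim
    case (elim r)
    define A where "A = ball x r"
    have "A \<subseteq> \<Omega>" using elim(1) ball_subset_cball unfolding A_def by blast
    define I where "I = (LINT y:A|\<mu>. \<phi> y - \<phi> x)"
    define k where "k = 1 / r\<^sup>2 * (1 / measure \<mu> A)"
    have "k > 0"
      unfolding k_def A_def using measure_ball_pos[of r x] elim(1) by simp
    have int: "set_integrable \<mu> A (\<lambda>y. \<phi> y - \<phi> x)"
      unfolding A_def
    proof (rule set_integrable_bounded_ball)
      show "(\<lambda>y. \<phi> y - \<phi> x) \<in> borel_measurable (restrict_space \<mu> \<Omega>)"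
        using meas by measurable
      show "\<bar>\<phi> y - \<phi> x\<bar> \<le> B + B" if "y \<in> \<Omega>" for y
        using bound[OF that] bound[OF \<open>x \<in> \<Omega>\<close>] by linarith
    qed (use \<open>A \<subseteq> \<Omega>\<close> A_def in auto)
    have \<phi>: "AMV_quotient \<mu> r (\<lambda>x. ereal (\<phi> x)) x = ereal (k * I)"
      unfolding AMV_quotient_def ball_average_def A_def[symmetric]
      using ext_integral_eq_set_integral[OF int] by (simp add: I_def k_def)
    have "ext_integral \<mu> A (\<lambda>y. u y - u x) \<le> ext_integral \<mu> A (\<lambda>y. ereal (- \<epsilon> * (\<phi> y - \<phi> x)))"
    proof (rule ext_integral_mono)
      fix y assume "y \<in> A"
      with max[of y] \<open>A \<subseteq> \<Omega>\<close> have "u y + ereal (\<epsilon> * \<phi> y) \<le> ereal (a + \<epsilon> * \<phi> x)"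
        by (auto simp: ux)
      then show "u y - u x \<le> ereal (- \<epsilon> * (\<phi> y - \<phi> x))"
        by (cases "u y") (auto simp: ux algebra_simps)
    qed
    also have "\<dots> = ereal (- \<epsilon> * I)"
    proof -
      have "set_integrable \<mu> A (\<lambda>y. - \<epsilon> * (\<phi> y - \<phi> x))"
        using int by (intro set_integrable_mult_right) auto
      from ext_integral_eq_set_integral[OF this] show ?thesis
        unfolding I_def set_integral_mult_right .
    qed
    finally have "ereal k * ext_integral \<mu> A (\<lambda>y. u y - u x) \<le> ereal k * ereal (- \<epsilon> * I)"
      using \<open>k > 0\<close> by (intro ereal_mult_left_mono) auto
    then have "AMV_quotient \<mu> r u x \<le> ereal (- \<epsilon> * (k * I))"
      unfolding AMV_quotient_def ball_average_def A_def[symmetric]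
      by (simp add: k_def mult.assoc[symmetric] mult_ac)
    also have "\<dots> \<le> ereal (- \<epsilon> * \<delta>)"
      using elim(2) \<open>\<epsilon> > 0\<close> unfolding \<phi> by simp
    finally show ?case .
  qed
  then have "upper_AMV_Laplacian \<mu> u x \<le> ereal (- \<epsilon> * \<delta>)"
    unfolding upper_AMV_Laplacian_def by (rule Limsup_bounded)
  also have "\<dots> < 0" using \<delta>(1) \<open>\<epsilon> > 0\<close> by simp
  finally show ?thesis .
qed

text \<open>
  A locally integrable function is finite almost everywhere, so \<open>u y - \<infinity> = -\<infinity>\<close> for almost all
  \<open>y\<close> in a small ball around \<open>x\<close>.
\<close>
lemma upper_AMV_Laplacian_neg_at_PInfty:
  fixes \<mu> :: "'a::heine_borel measure"
  assumes mms: "metric_measure_space \<mu>" and "open \<Omega>" "x \<in> \<Omega>"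
    and L1: "L1_loc \<mu> \<Omega> u" and ux: "u x = \<infinity>"
  shows "upper_AMV_Laplacian \<mu> u x < 0"
proof -
  interpret metric_measure_space \<mu> by fact
  have sp: "space \<mu> = UNIV" using sets_eq_imp_space_eq[OF sets_borel] by simp
  have "eventually (\<lambda>r. AMV_quotient \<mu> r u x \<le> -\<infinity>) (at_right 0)"
    using eventually_small_ball[OF assms(2,3)]
  proof eventually_elim
    case (elim r)
    define A where "A = ball x r"
    have A: "A \<subseteq> cball x r" "A \<in> sets \<mu>" "cball x r \<in> sets \<mu>"
      unfolding A_def using sets_borel by auto
    have \<mu>A: "emeasure \<mu> A > 0"
      unfolding A_def using elim by (intro open_pos) auto
    let ?h = "\<lambda>y. e2ennreal \<bar>u y\<bar> * indicator (cball x r) y"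
    have "u \<in> borel_measurable (restrict_space \<mu> \<Omega>)" using L1 unfolding L1_loc_def by simp
    then have "u \<in> borel_measurable (restrict_space \<mu> (cball x r))"
      using elim by (blast intro: measurable_restrict_mono[of u \<mu> \<Omega>])
    then have "(\<lambda>y. e2ennreal \<bar>u y\<bar>) \<in> borel_measurable (restrict_space \<mu> (cball x r))"
      by measurable
    then have "?h \<in> borel_measurable \<mu>"
      using borel_measurable_restrict_space_iff_ennreal[of "cball x r" \<mu>] A by (simp add: sp)
    moreover have "(\<integral>\<^sup>+y. ?h y \<partial>\<mu>) \<noteq> \<infinity>"
      using L1 elim unfolding L1_loc_def by (metis compact_cball less_irrefl)
    ultimately have "AE y in \<mu>. ?h y \<noteq> \<infinity>"
      by (rule nn_integral_PInf_AE)
    then have fin: "AE y in \<mu>. y \<in> A \<longrightarrow> u y \<noteq> \<infinity>"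
      by eventually_elim (use A in \<open>auto split: split_indicator_asm\<close>)
    have "(\<integral>\<^sup>+y\<in>A. e2ennreal (u y - u x) \<partial>\<mu>) = (\<integral>\<^sup>+y. 0 \<partial>\<mu>)"
    proof (rule nn_integral_cong_AE)
      show "AE y in \<mu>. e2ennreal (u y - u x) * indicator A y = 0"
        using fin
      proof eventually_elim
        case (elim y)
        then show ?case by (cases "u y") (auto simp: ux e2ennreal_neg split: split_indicator)
      qed
    qed
    moreover have "(\<integral>\<^sup>+y\<in>A. e2ennreal (- (u y - u x)) \<partial>\<mu>) = (\<integral>\<^sup>+y\<in>A. \<infinity> \<partial>\<mu>)"
    proof (rule nn_integral_cong_AE)
      show "AE y in \<mu>. e2ennreal (- (u y - u x)) * indicator A y = \<infinity> * indicator A y"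
        using fin
      proof eventually_elim
        case (elim y)
        then show ?case by (cases "u y") (auto simp: ux split: split_indicator)
      qed
    qed
    moreover have "(\<integral>\<^sup>+y\<in>A. \<infinity> \<partial>\<mu>) = \<infinity>"
      using nn_integral_cmult_indicator[OF A(2), of \<infinity>] \<mu>A by (simp add: ennreal_top_mult)
    ultimately have "ext_integral \<mu> A (\<lambda>y. u y - u x) = -\<infinity>"
      unfolding ext_integral_def by (simp add: zero_ennreal.rep_eq)
    then show ?case
      unfolding AMV_quotient_def ball_average_def A_def[symmetric]
      using measure_ball_pos[of r x] elim by (simp add: A_def)
  qed
  then have "upper_AMV_Laplacian \<mu> u x \<le> -\<infinity>"
    unfolding upper_AMV_Laplacian_def by (rule Limsup_bounded)
  then show ?thesis by simp
qed

section \<open>The maximum principle\<close>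

text \<open>
  The conclusion produces a point of the frontier, so that for \<open>u = 0\<close> it says that the frontier of
  a domain carrying such a \<open>\<phi>\<close> is not empty. The perturbation \<open>u + \<epsilon> \<phi>\<close> moves the maximum to a
  point of \<open>\<Omega>\<close> at which the upper Laplacian of \<open>u\<close> is negative.
\<close>
lemma max_attained_on_frontier:
  fixes \<mu> :: "'a::heine_borel measure" and u :: "'a \<Rightarrow> ereal" and \<phi> :: "'a \<Rightarrow> real"
  assumes mms: "metric_measure_space \<mu>" and "open \<Omega>" "bounded \<Omega>"
    and usc: "usc_on (closure \<Omega>) u"
    and upper: "\<And>x. x \<in> \<Omega> \<Longrightarrow> upper_AMV_Laplacian \<mu> u x \<ge> 0"
    and bdd: "bounded (\<phi> ` closure \<Omega>)"
    and usc\<phi>: "usc_on (closure \<Omega>) (\<lambda>x. ereal (\<phi> x))"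
    and lower: "\<And>x. x \<in> \<Omega> \<Longrightarrow> lower_AMV_Laplacian \<mu> (\<lambda>x. ereal (\<phi> x)) x > 0"
    and x0: "x0 \<in> closure \<Omega>" "u x0 = ereal M" and max: "\<And>y. y \<in> closure \<Omega> \<Longrightarrow> u y \<le> ereal M"
  shows "\<exists>x\<in>frontier \<Omega>. u x = ereal M"
proof (rule ccontr)
  assume no: "\<not> ?thesis"
  interpret metric_measure_space \<mu> by fact
  have cpt: "compact (closure \<Omega>)"
    using \<open>bounded \<Omega>\<close> by (simp add: compact_closure)
  have front: "frontier \<Omega> \<subseteq> closure \<Omega>" by (simp add: frontier_def)
  have "\<exists>c<M. \<forall>y\<in>frontier \<Omega>. u y \<le> ereal c"
  proof (cases "frontier \<Omega> = {}")
    case True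
    then show ?thesis by (intro exI[of _ "M - 1"]) auto
  next
    case False
    have "compact (frontier \<Omega>)" using \<open>bounded \<Omega>\<close> by (rule compact_frontier_bounded)
    then obtain z where z: "z \<in> frontier \<Omega>" "\<And>y. y \<in> frontier \<Omega> \<Longrightarrow> u y \<le> u z"
      using usc_on_compact_attains_max[OF usc_on_subset[OF usc front]] False by blast
    have "u z < ereal M" using z(1) no max front by (metis order_le_less subsetD)
    then obtain c where "u z < ereal c" "ereal c < ereal M" using ereal_dense2 by blast
    with z(2) show ?thesis by (intro exI[of _ c]) (auto intro: order_trans less_imp_le)
  qed
  then obtain c where c: "c < M" "\<And>y. y \<in> frontier \<Omega> \<Longrightarrow> u y \<le> ereal c" by blast
  obtain B where B: "B > 0" "\<And>y. y \<in> closure \<Omega> \<Longrightarrow> \<bar>\<phi> y\<bar> \<le> B"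
    using bdd unfolding bounded_pos by auto
  \<comment> \<open>The perturbed function is at most \<open>c + \<epsilon> * B\<close> on the frontier and at least \<open>M - \<epsilon> * B\<close> at \<open>x0\<close>.\<close>
  define \<epsilon> where "\<epsilon> = (M - c) / (3 * B)"
  have \<epsilon>: "\<epsilon> > 0" "c + \<epsilon> * B < M - \<epsilon> * B"
    using c(1) B(1) by (auto simp: \<epsilon>_def field_simps)
  have \<epsilon>B: "\<bar>\<epsilon> * \<phi> y\<bar> \<le> \<epsilon> * B" if "y \<in> closure \<Omega>" for y
    using B(2)[OF that] \<epsilon>(1) by (simp add: abs_mult)
  obtain x where x: "x \<in> closure \<Omega>"
    and xmax: "\<And>y. y \<in> closure \<Omega> \<Longrightarrow> u y + ereal (\<epsilon> * \<phi> y) \<le> u x + ereal (\<epsilon> * \<phi> x)"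
  proof (rule usc_on_compact_attains_max[OF usc_on_add_scaled[OF usc usc\<phi> \<epsilon>(1)] cpt])
    show "closure \<Omega> \<noteq> {}" using x0(1) by (metis empty_iff)
  qed (use that in blast)
  have ge: "ereal (M + \<epsilon> * \<phi> x0) \<le> u x + ereal (\<epsilon> * \<phi> x)"
    using xmax[OF x0(1)] x0(2) by simp
  then obtain a where a: "u x = ereal a"
    using max[OF x] by (cases "u x") auto
  have "x \<notin> frontier \<Omega>"
  proof
    assume "x \<in> frontier \<Omega>"
    then have "a \<le> c" using c(2)[of x] a by simp
    moreover have "M + \<epsilon> * \<phi> x0 \<le> a + \<epsilon> * \<phi> x" using ge a by simp
    ultimately show False using \<epsilon>(2) \<epsilon>B[OF x] \<epsilon>B[OF x0(1)] by linarith
  qed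
  then have "x \<in> \<Omega>"
    using x \<open>open \<Omega>\<close> by (auto simp: frontier_def interior_open)
  have "\<Omega> \<subseteq> closure \<Omega>" by (rule closure_subset)
  have "upper_AMV_Laplacian \<mu> u x < 0"
  proof (rule upper_AMV_Laplacian_neg_at_perturbed_max)
    show "\<phi> \<in> borel_measurable (restrict_space \<mu> \<Omega>)"
      using usc_on_subset[OF usc\<phi> closure_subset] \<open>open \<Omega>\<close> sets_borel
      by (rule usc_on_open_borel_measurable)
  qed (use \<open>open \<Omega>\<close> \<open>x \<in> \<Omega>\<close> \<open>\<Omega> \<subseteq> closure \<Omega>\<close> \<epsilon>(1) B(2) a xmax lower in auto)
  with upper[OF \<open>x \<in> \<Omega>\<close>] show False by simp
qed

theorem theorem4p3:
  fixes \<mu> :: "'a::heine_borel measure"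
    and \<Omega> :: "'a set"
    and u :: "'a \<Rightarrow> ereal"
    and \<phi> :: "'a \<Rightarrow> real"
  assumes "metric_measure_space \<mu>"
    and "bounded_domain \<Omega>"
    and "L1_loc \<mu> \<Omega> u"
    and "limit_of_averages_on \<mu> \<Omega> u"
    and "usc_on (closure \<Omega>) u"
    and "\<forall>x\<in>\<Omega>. upper_AMV_Laplacian \<mu> u x \<ge> 0"
    and "bounded (\<phi> ` closure \<Omega>)"
    and "usc_on (closure \<Omega>) (\<lambda>x. ereal (\<phi> x))"
    and "\<forall>x\<in>\<Omega>. lower_AMV_Laplacian \<mu> (\<lambda>x. ereal (\<phi> x)) x > 0"
  shows "\<exists>M. is_max_on u (frontier \<Omega>) M \<and> is_max_on u (closure \<Omega>) M"
proof -
  have \<Omega>: "\<Omega> \<noteq> {}" "open \<Omega>" "bounded \<Omega>" "\<Omega> \<subseteq> closure \<Omega>"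
    using assms(2) closure_subset unfolding bounded_domain_def by auto
  have front: "frontier \<Omega> = closure \<Omega> - \<Omega>"
    using \<Omega>(2) by (simp add: frontier_def interior_open)
  note principle = max_attained_on_frontier[OF assms(1) \<Omega>(2,3) _ _ assms(7,8)]
  have "compact (closure \<Omega>)" "closure \<Omega> \<noteq> {}"
    using \<Omega> by (auto simp: compact_closure)
  then obtain x0 where x0: "x0 \<in> closure \<Omega>" "\<And>y. y \<in> closure \<Omega> \<Longrightarrow> u y \<le> u x0"
    using usc_on_compact_attains_max[OF assms(5)] by blast
  have "\<exists>x\<in>frontier \<Omega>. u x = u x0"
  proof (cases "u x0")
    case (real M)
    then show ?thesis
      using principle[of u x0 M] assms(5,6,9) x0 by auto
  next
    case PInf
    have "x0 \<notin> \<Omega>"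
      using upper_AMV_Laplacian_neg_at_PInfty[of \<mu> \<Omega> x0 u] PInf assms(1,3,6) \<Omega>(2)
      by (meson leD)
    then show ?thesis using x0(1) front by blast
  next
    case MInf
    \<comment> \<open>Here \<open>u\<close> is constantly \<open>-\<infinity>\<close> on \<open>closure \<Omega>\<close>, so any point of the frontier will do.\<close>
    have "usc_on (closure \<Omega>) (\<lambda>_. 0)"
      by (auto simp: usc_on_iff_eventually_less)
    moreover have "upper_AMV_Laplacian \<mu> (\<lambda>_. 0) x \<ge> 0" for x
      by (simp add: upper_AMV_Laplacian_def AMV_quotient_def ball_average_def ext_integral_def
          e2ennreal_neg zero_ennreal.rep_eq Limsup_const)
    ultimately obtain z where "z \<in> frontier \<Omega>"
      using principle[of "\<lambda>_. 0" x0 0] assms(9) x0(1) by auto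
    moreover have "u z \<le> -\<infinity>"
      using x0(2)[of z] MInf calculation front by auto
    ultimately show ?thesis using MInf by auto
  qed
  then obtain x where "x \<in> frontier \<Omega>" "u x = u x0" by blast
  with x0 front show ?thesis
    unfolding is_max_on_def by (intro exI[of _ "u x0"]) (auto intro: rev_image_eqI)
qed

end
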